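(* For every pair of integers $d\ge 2$ and $k\ge 4d-1$, there is a connected block graph $G_{d,k}$ such that $L(G_{d,k})=k$ and $\chi_{=}(G_{d,k})=k+d$.
   Context: All graphs are finite and simple, and all numbers of colors are positive integers. An equitable $q$-coloring of a graph $G$ is a proper vertex coloring with $q$ colors in which every color class has size $\lfloor |V(G)|/q\rfloor$ or $\lceil |V(G)|/q\rceil$. The equitable chromatic number $\chi_{=}(G)$ is the least $q$ for which $G$ has an equitable $q$-coloring. For $v\in V(G)$ let $\alpha(G,v)=\max\{|I| : I\subseteq V(G)\text{ is independent and } v\in I\}$, and let $\alpha_{\min}(G)=\min_{v\in V(G)}\alpha(G,v)$. With $\omega(G)$ denoting the clique number, let $L(G)=\max\left\{\omega(G),\left\lceil \frac{|V(G)|+1}{\alpha_{\min}(G)+1}\right\rceil\right\}$. A block graph is a graph all of whose blocks are cliques (complete graphs), where a block is a maximal connected subgraph having no cut vertex of its own. *)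

theory Defs
  imports Complex_Main "Graph_Theory.Graph_Theory"
begin

text \<open>
  A finite simple graph is a digraph satisfying the locale predicate \<open>graph\<close> (finite, symmetric,
  without loops and parallel arcs): an undirected edge \<open>uv\<close> is the pair of arcs \<open>(u, v)\<close>, \<open>(v, u)\<close>,
  and adjacency is membership in \<open>arcs_ends G\<close>. The definitions below are meant for such graphs;
  \<open>alpha_min\<close> moreover presupposes \<open>verts G \<noteq> {}\<close>, which \<open>connected G\<close> entails.
\<close>

definition independent_set :: "('a, 'b) pre_digraph \<Rightarrow> 'a set \<Rightarrow> bool" where
  "independent_set G I \<longleftrightarrow> I \<subseteq> verts G \<and> (\<forall>u\<in>I. \<forall>v\<in>I. (u, v) \<notin> arcs_ends G)"

definition clique :: "('a, 'b) pre_digraph \<Rightarrow> 'a set \<Rightarrow> bool" where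
  "clique G C \<longleftrightarrow> C \<subseteq> verts G \<and> (\<forall>u\<in>C. \<forall>v\<in>C. u \<noteq> v \<longrightarrow> (u, v) \<in> arcs_ends G)"

definition clique_number :: "('a, 'b) pre_digraph \<Rightarrow> nat" where
  "clique_number G = Max {card C | C. clique G C}"

definition alpha_at :: "('a, 'b) pre_digraph \<Rightarrow> 'a \<Rightarrow> nat" where
  "alpha_at G v = Max {card I | I. independent_set G I \<and> v \<in> I}"

definition alpha_min :: "('a, 'b) pre_digraph \<Rightarrow> nat" where
  "alpha_min G = Min (alpha_at G ` verts G)"

definition lower_bound_L :: "('a, 'b) pre_digraph \<Rightarrow> nat" where
  "lower_bound_L G =
     max (clique_number G) (nat \<lceil>(real (card (verts G)) + 1) / (real (alpha_min G) + 1)\<rceil>)"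

text \<open>Colors are \<open>0, \<dots>, q - 1\<close>; color classes may be empty.\<close>

definition proper_coloring :: "('a, 'b) pre_digraph \<Rightarrow> nat \<Rightarrow> ('a \<Rightarrow> nat) \<Rightarrow> bool" where
  "proper_coloring G q c \<longleftrightarrow>
     (\<forall>v\<in>verts G. c v < q) \<and> (\<forall>(u, v)\<in>arcs_ends G. c u \<noteq> c v)"

definition equitable_coloring :: "('a, 'b) pre_digraph \<Rightarrow> nat \<Rightarrow> ('a \<Rightarrow> nat) \<Rightarrow> bool" where
  "equitable_coloring G q c \<longleftrightarrow> proper_coloring G q c \<and>
     (\<forall>i<q. int (card {v \<in> verts G. c v = i}) \<in>
        {\<lfloor>real (card (verts G)) / real q\<rfloor>, \<lceil>real (card (verts G)) / real q\<rceil>})"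

definition equitable_chromatic_number :: "('a, 'b) pre_digraph \<Rightarrow> nat" where
  "equitable_chromatic_number G = (LEAST q. 0 < q \<and> (\<exists>c. equitable_coloring G q c))"

text \<open>A cut vertex separates two other vertices of its component.\<close>

definition cut_vertex :: "('a, 'b) pre_digraph \<Rightarrow> 'a \<Rightarrow> bool" where
  "cut_vertex H v \<longleftrightarrow> v \<in> verts H \<and>
     (\<exists>u \<in> verts H - {v}. \<exists>w \<in> verts H - {v}.
        u \<rightarrow>\<^sup>*\<^bsub>H\<^esub> w \<and> \<not> u \<rightarrow>\<^sup>*\<^bsub>pre_digraph.del_vert H v\<^esub> w)"

text \<open>
  The subgraphs of \<open>G\<close> as an undirected graph are its symmetric subdigraphs, hence the conjunct
  \<open>graph H\<close>. They need not be induced, and maximality refers to the subgraph relation.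
\<close>

definition is_block :: "('a, 'b) pre_digraph \<Rightarrow> ('a, 'b) pre_digraph \<Rightarrow> bool" where
  "is_block G B \<longleftrightarrow>
     pre_digraph.max_subgraph G (\<lambda>H. graph H \<and> connected H \<and> \<not> (\<exists>v. cut_vertex H v)) B"

definition block_graph :: "('a, 'b) pre_digraph \<Rightarrow> bool" where
  "block_graph G \<longleftrightarrow> graph G \<and> (\<forall>B. is_block G B \<longrightarrow> complete_digraph (card (verts B)) B)"

end

theory Submission
  imports Defs "HOL-Library.Countable"
begin

text \<open>
  The bound \<open>L\<close> looks at one vertex at a time: if \<open>v\<close> lies in no large independent set, then its
  color class is small. It does not see two adjacent vertices that can each be completed to a large
  independent set, but only by using the same few vertices. The graph below exploits this.

  Take two adjacent vertices, the hubs. Join each hub \<open>b\<close> to \<open>p\<close> disjoint cliques of size \<open>k - 1\<close>,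
  whose vertices are called cells, and hang \<open>r\<close> leaves on one cell of the hub \<open>b\<close>. An independent
  set containing a hub has at most one vertex in each of the \<open>p\<close> cliques of the other hub, none in
  its own cliques, and possibly all \<open>2 * r\<close> leaves: its size can reach \<open>1 + p + 2 * r\<close>. The classes
  of the two hubs in a proper coloring share the leaves, so together they have at most
  \<open>2 * (1 + p + r)\<close> vertices (\<open>independent_sets_at_hubs_bound\<close>). Hence no equitable \<open>q\<close>-coloring
  exists once all its classes need \<open>2 + p + r\<close> vertices.

  With \<open>p = k + d - 2\<close> and \<open>r = k - d - 3\<close> the number of vertices is exactly \<open>(k + d) * s\<close> for
  \<open>s = 1 + p + r = 2 * (k - 2)\<close>. Since \<open>s\<close> is at least \<open>k + d - 1\<close>, fewer than \<open>k + d\<close> colors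
  force classes of size at least \<open>s + 1\<close>, which the hubs exclude. With \<open>k + d\<close> colors, give the
  hubs two colors, use each of them on half of the leaves and once in every clique of the other hub;
  the remaining \<open>k - 2\<close> cells of each clique are colored cyclically with the \<open>p\<close> other colors
  (\<open>equitable_coloring_the_graph\<close>).

  The clique number is \<open>k\<close>. A cell or leaf lies in an independent set of size \<open>2 * p\<close>, which is
  harmless for \<open>L\<close>; at a hub, \<open>L \<le> k\<close> amounts to \<open>k * (3 * d + 2) \<le> k * k + 4 * d - 1\<close>, and this
  is where \<open>k \<ge> 4 * d - 1\<close> enters. For \<open>d = 2\<close> and \<open>k = 7\<close> it is an equality.
\<close>

section \<open>Block graphs via separating vertices\<close>

lemma (in graph) connectedI_reachable:
  assumes "r \<in> verts G" and "\<And>v. v \<in> verts G \<Longrightarrow> v \<rightarrow>\<^sup>* r"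
  shows "connected G"
  unfolding connected_def
proof
  show "verts (with_proj (mk_symmetric G)) \<noteq> {}"
    using assms(1) by auto
next
  fix u v
  assume "u \<in> verts (with_proj (mk_symmetric G))" "v \<in> verts (with_proj (mk_symmetric G))"
  then have "u \<rightarrow>\<^sup>* r" "r \<rightarrow>\<^sup>* v"
    using assms(2) symmetric_reachable' by auto
  then have "u \<rightarrow>\<^sup>* v" by (rule reachable_trans)
  then show "u \<rightarrow>\<^sup>*\<^bsub>with_proj (mk_symmetric G)\<^esub> v"
    by (rule reachable_mk_symmetricI)
qed

lemma complete_digraph_connected:
  assumes "complete_digraph m K" and "verts K \<noteq> {}"
  shows "connected K"
proof -
  interpret graph K using assms(1) by (simp add: complete_digraph_def)
  obtain r where r: "r \<in> verts K" using assms(2) by blast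
  have "v \<rightarrow>\<^sup>*\<^bsub>K\<^esub> r" if "v \<in> verts K" for v
    using assms(1) that r by (cases "v = r") (auto simp: complete_digraph_def)
  with r show ?thesis by (rule connectedI_reachable)
qed

lemma complete_digraph_no_cut_vertex:
  assumes "complete_digraph m K"
  shows "\<not> cut_vertex K v"
proof
  assume "cut_vertex K v"
  then obtain a b where ab: "a \<in> verts K - {v}" "b \<in> verts K - {v}"
    and not_reach: "\<not> a \<rightarrow>\<^sup>*\<^bsub>pre_digraph.del_vert K v\<^esub> b"
    unfolding cut_vertex_def by blast
  interpret graph K using assms by (simp add: complete_digraph_def)
  interpret D: wf_digraph "del_vert v" by (rule wf_digraph_del_vert)
  have "a \<rightarrow>\<^sup>*\<^bsub>del_vert v\<^esub> b"
  proof (cases "a = b")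
    case True
    with ab show ?thesis by (auto simp: del_vert_simps)
  next
    case False
    then have "(a, b) \<in> arcs_ends K"
      using assms ab by (auto simp: complete_digraph_def)
    then obtain e where "e \<in> arcs K" "tail K e = a" "head K e = b" by (rule reachableE)
    then have "(a, b) \<in> arcs_ends (del_vert v)"
      using ab by (auto simp: arcs_ends_conv del_vert_simps image_iff intro!: bexI[of _ e])
    then show ?thesis by (rule D.reachable_adjI)
  qed
  with not_reach show False by contradiction
qed

lemma (in wf_digraph) reachable_preserves:
  assumes "a \<rightarrow>\<^sup>* b" and "\<And>x y. x \<rightarrow> y \<Longrightarrow> x \<in> S \<longleftrightarrow> y \<in> S"
  shows "a \<in> S \<longleftrightarrow> b \<in> S"
  using assms(1) by (induction rule: reachable_induct) (auto dest: assms(2))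

text \<open>
  A set \<open>S\<close> that no edge avoiding \<open>v\<close> leaves is a union of components once \<open>v\<close> is deleted. A path
  from \<open>a\<close> to \<open>b\<close> avoiding \<open>v\<close> exists in \<open>H\<close>, either because \<open>v\<close> is no cut vertex or because \<open>v\<close>
  is not even a vertex of \<open>H\<close>.
\<close>
lemma connected_without_cut_vertex_not_separated:
  assumes "graph H" "connected H" "\<nexists>v. cut_vertex H v"
    and ab: "a \<in> verts H" "b \<in> verts H" "v \<noteq> a" "v \<noteq> b"
    and S: "\<And>x y. (x, y) \<in> arcs_ends H \<Longrightarrow> x \<noteq> v \<Longrightarrow> y \<noteq> v \<Longrightarrow> x \<in> S \<longleftrightarrow> y \<in> S"
  shows "a \<in> S \<longleftrightarrow> b \<in> S"
proof -
  interpret graph H by fact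
  interpret D: wf_digraph "del_vert v" by (rule wf_digraph_del_vert)
  have reach: "a \<rightarrow>\<^sup>*\<^bsub>H\<^esub> b"
    using symmetric_connected_imp_strongly_connected[OF sym_arcs \<open>connected H\<close>] ab
    by (auto simp: strongly_connected_def)
  show ?thesis
  proof (cases "v \<in> verts H")
    case True
    then have "a \<rightarrow>\<^sup>*\<^bsub>del_vert v\<^esub> b"
      using assms(3) ab reach unfolding cut_vertex_def by blast
    moreover have "(x, y) \<in> arcs_ends H \<and> x \<noteq> v \<and> y \<noteq> v"
      if "(x, y) \<in> arcs_ends (del_vert v)" for x y
      using that by (auto simp: arcs_ends_conv del_vert_simps)
    ultimately show ?thesis
      using D.reachable_preserves[of a b S] S by blast
  next
    case False
    show ?thesis
      using reach by (rule reachable_preserves) (metis False S adj_in_verts)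
  qed
qed

text \<open>
  If any two nonadjacent vertices are separated by a single vertex, then a connected subgraph without
  cut vertices contains no two of them. So the vertices of a block are pairwise adjacent in \<open>G\<close>; the
  subgraph that they induce is complete, hence an admissible competitor, and by maximality it is the
  block. This spares a classification of all blocks.
\<close>
lemma block_graphI_separated:
  assumes "graph G"
    and sep: "\<And>a b. a \<in> verts G \<Longrightarrow> b \<in> verts G \<Longrightarrow> a \<noteq> b \<Longrightarrow> (a, b) \<notin> arcs_ends G \<Longrightarrow>
      \<exists>v S. v \<noteq> a \<and> v \<noteq> b \<and> (a \<in> S \<longleftrightarrow> b \<notin> S) \<and>
        (\<forall>(x, y) \<in> arcs_ends G. x \<noteq> v \<longrightarrow> y \<noteq> v \<longrightarrow> (x \<in> S \<longleftrightarrow> y \<in> S))"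
  shows "block_graph G"
  unfolding block_graph_def
proof (intro conjI allI impI)
  show "graph G" by fact
  fix B assume "is_block G B"
  interpret graph G by fact
  have B: "subgraph B G" "graph B" "connected B" "\<nexists>v. cut_vertex B v"
    and maximal: "\<And>H. subgraph B H \<Longrightarrow> subgraph H G \<Longrightarrow> graph H \<Longrightarrow> connected H \<Longrightarrow>
        \<nexists>v. cut_vertex H v \<Longrightarrow> H = B"
    using \<open>is_block G B\<close> unfolding is_block_def max_subgraph_def by blast+
  interpret B: graph B by fact
  have sub: "verts B \<subseteq> verts G" "arcs_ends B \<subseteq> arcs_ends G"
    using B(1) by (auto simp: subgraph_def compatible_def arcs_ends_conv)
  have adjacent: "(a, b) \<in> arcs_ends G" if ab: "a \<in> verts B" "b \<in> verts B" "a \<noteq> b" for a b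
  proof (rule ccontr)
    assume "(a, b) \<notin> arcs_ends G"
    with sep[of a b] ab sub(1) obtain v S where v: "v \<noteq> a" "v \<noteq> b"
      and ne: "a \<in> S \<longleftrightarrow> b \<notin> S"
      and S: "\<forall>(x, y) \<in> arcs_ends G. x \<noteq> v \<longrightarrow> y \<noteq> v \<longrightarrow> (x \<in> S \<longleftrightarrow> y \<in> S)"
      by auto
    have "a \<in> S \<longleftrightarrow> b \<in> S"
      using connected_without_cut_vertex_not_separated[OF B(2-4) ab(1,2) v, of S] S sub(2)
      by blast
    with ne show False by blast
  qed
  let ?K = "G \<restriction> verts B"
  have KG: "subgraph ?K G" using sub(1) by (rule subgraph_induce_subgraphI)
  have "arcs_ends ?K = {(u, v) \<in> arcs_ends G. u \<in> verts B \<and> v \<in> verts B}"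
    by (auto simp: arcs_ends_conv)
  then have ends: "arcs_ends ?K = {(u, v). (u, v) \<in> verts B \<times> verts B \<and> u \<noteq> v}"
    using adjacent adj_not_same by auto
  have "graph ?K"
  proof -
    interpret K: wf_digraph ?K using KG by (simp add: subgraph_def)
    have "digraph ?K"
    proof
      show "finite (verts ?K)" "finite (arcs ?K)" by simp_all
      show "tail ?K e \<noteq> head ?K e" if "e \<in> arcs ?K" for e
        using that no_loops by simp
      show "e = e'" if "e \<in> arcs ?K" "e' \<in> arcs ?K" "arc_to_ends ?K e = arc_to_ends ?K e'" for e e'
        using that no_multi_arcs by (simp add: arc_to_ends_def)
    qed
    moreover have "symmetric ?K"
      using ends by (auto simp: symmetric_def sym_def)
    ultimately show ?thesis by (rule digraph.graphI)
  qed
  then have complete: "complete_digraph (card (verts B)) ?K"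
    using ends by (simp add: complete_digraph_def)
  have "verts ?K \<noteq> {}"
    using B(3) by (auto simp: connected_conv)
  have "?K = B"
  proof (rule maximal)
    show "subgraph B ?K" using B(1) by (rule subgraph_induce_subgraphI2)
    show "connected ?K"
      using complete \<open>verts ?K \<noteq> {}\<close> by (rule complete_digraph_connected)
    show "\<nexists>v. cut_vertex ?K v"
      using complete_digraph_no_cut_vertex[OF complete] by blast
  qed fact+
  with complete show "complete_digraph (card (verts B)) B" by simp
qed

section \<open>Computing the lower bound and the equitable chromatic number\<close>

text \<open>A proper coloring is injective on cliques, so one with \<open>card C\<close> colors certifies \<open>C\<close>.\<close>
lemma clique_number_eqI:
  assumes "finite (verts G)" and "clique G C" and "proper_coloring G (card C) c"
  shows "clique_number G = card C"
  unfolding clique_number_def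
proof (rule Max_eqI)
  have "{card C | C. clique G C} \<subseteq> card ` Pow (verts G)"
    by (auto simp: clique_def)
  then show "finite {card C | C. clique G C}"
    using assms(1) by (simp add: finite_subset)
  show "card C \<in> {card C | C. clique G C}" using assms(2) by blast
  fix m assume "m \<in> {card C | C. clique G C}"
  then obtain D where m: "m = card D" and D: "clique G D" by blast
  have "inj_on c D"
    using D assms(3) by (fastforce simp: inj_on_def clique_def proper_coloring_def)
  then have "card D = card (c ` D)" by (simp add: card_image)
  also have "\<dots> \<le> card {..<card C}"
    using D assms(3) by (intro card_mono) (auto simp: clique_def proper_coloring_def)
  finally show "m \<le> card C" using m by simp
qed

text \<open>
  The ceiling in \<open>L\<close> is monotone in \<open>alpha_min\<close>, so a sufficiently large independent set through each
  vertex is enough; the exact values of \<open>alpha_at\<close> never have to be found.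
\<close>
lemma lower_bound_L_eq_clique_number:
  assumes "finite (verts G)" "verts G \<noteq> {}"
    and alpha: "\<And>v. v \<in> verts G \<Longrightarrow> \<exists>I. independent_set G I \<and> v \<in> I \<and>
      card (verts G) + 1 \<le> clique_number G * (card I + 1)"
  shows "lower_bound_L G = clique_number G"
proof -
  have "alpha_min G \<in> alpha_at G ` verts G"
    unfolding alpha_min_def using assms(1,2) by simp
  then obtain v where v: "v \<in> verts G" "alpha_min G = alpha_at G v" by blast
  obtain I where I: "independent_set G I" "v \<in> I"
      "card (verts G) + 1 \<le> clique_number G * (card I + 1)"
    using alpha[OF v(1)] by blast
  have "{card I | I. independent_set G I \<and> v \<in> I} \<subseteq> card ` Pow (verts G)"
    by (auto simp: independent_set_def)
  then have "finite {card I | I. independent_set G I \<and> v \<in> I}"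
    using assms(1) by (simp add: finite_subset)
  then have "card I \<le> alpha_min G"
    unfolding v(2) alpha_at_def using I(1,2) by (intro Max_ge) blast+
  then have "card (verts G) + 1 \<le> clique_number G * (alpha_min G + 1)"
    using I(3) by (meson add_le_mono1 le_trans mult_le_mono2)
  then have "real (card (verts G) + 1) \<le> real (clique_number G * (alpha_min G + 1))"
    by (simp only: of_nat_le_iff)
  then have "(real (card (verts G)) + 1) / (real (alpha_min G) + 1) \<le> real (clique_number G)"
    by (simp add: pos_divide_le_eq algebra_simps)
  then have "nat \<lceil>(real (card (verts G)) + 1) / (real (alpha_min G) + 1)\<rceil> \<le> clique_number G"
    by (simp add: ceiling_le_iff nat_le_iff)
  then show ?thesis by (simp add: lower_bound_L_def)
qed

lemma equitable_coloringI_equal_classes: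
  assumes "proper_coloring G q c" "0 < q" "card (verts G) = q * s"
    and "\<And>i. i < q \<Longrightarrow> card {v \<in> verts G. c v = i} = s"
  shows "equitable_coloring G q c"
  using assms by (auto simp: equitable_coloring_def)

lemma equitable_coloring_class_ge:
  assumes "equitable_coloring G q c" "i < q" "q * m \<le> card (verts G)"
  shows "m \<le> card {v \<in> verts G. c v = i}"
proof -
  have "real q * real m \<le> real (card (verts G))"
    using assms(3) by (metis of_nat_le_iff of_nat_mult)
  then have "real m \<le> real (card (verts G)) / real q"
    using assms(2) by (simp add: pos_le_divide_eq mult.commute)
  then have "int m \<le> \<lfloor>real (card (verts G)) / real q\<rfloor>"
    by (simp add: le_floor_iff)
  moreover have "int (card {v \<in> verts G. c v = i}) \<in>
      {\<lfloor>real (card (verts G)) / real q\<rfloor>, \<lceil>real (card (verts G)) / real q\<rceil>}"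
    using assms(1,2) by (simp add: equitable_coloring_def)
  moreover have "\<lfloor>real (card (verts G)) / real q\<rfloor> \<le> \<lceil>real (card (verts G)) / real q\<rceil>"
    by linarith
  ultimately have "int m \<le> int (card {v \<in> verts G. c v = i})"
    by (elim insertE emptyE) (simp_all only: order_trans)
  then show ?thesis by simp
qed

text \<open>
  The obstruction that \<open>L\<close> misses: the ends of an edge lie in two disjoint color classes, which may
  be too small on average although each end alone lies in a large independent set.
\<close>
lemma no_equitable_coloring_if_starved_edge:
  assumes "(u, v) \<in> arcs_ends G" "u \<in> verts G" "v \<in> verts G"
    and starved: "\<And>I J. independent_set G I \<Longrightarrow> independent_set G J \<Longrightarrow> u \<in> I \<Longrightarrow> v \<in> J \<Longrightarrow>
      I \<inter> J = {} \<Longrightarrow> card I + card J < 2 * m"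
    and "q * m \<le> card (verts G)"
  shows "\<not> equitable_coloring G q c"
proof
  assume eq: "equitable_coloring G q c"
  then have proper: "proper_coloring G q c" by (simp add: equitable_coloring_def)
  let ?cls = "\<lambda>w. {x \<in> verts G. c x = c w}"
  have "independent_set G (?cls w)" for w
    using proper by (auto simp: independent_set_def proper_coloring_def)
  moreover have "?cls u \<inter> ?cls v = {}"
    using proper assms(1) by (auto simp: proper_coloring_def)
  ultimately have "card (?cls u) + card (?cls v) < 2 * m"
    using assms(2,3) by (intro starved) auto
  moreover have "m \<le> card (?cls u)" "m \<le> card (?cls v)"
    using equitable_coloring_class_ge[OF eq _ assms(5)] proper assms(2,3)
    by (auto simp: proper_coloring_def)
  ultimately show False by simp
qed

section \<open>Graphs on countable types, encoded on the natural numbers\<close>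

text \<open>
  The construction is easiest to read on a datatype of vertices. As the vertices have to be natural
  numbers, it is transported along the injection \<open>to_nat\<close>, and the notions above are reduced
  to statements about \<open>V\<close> and \<open>adj\<close>.
\<close>
definition encoded_graph ::
    "'a::countable set \<Rightarrow> ('a \<Rightarrow> 'a \<Rightarrow> bool) \<Rightarrow> (nat, nat \<times> nat) pre_digraph" where
  "encoded_graph V adj = \<lparr>verts = to_nat ` V,
     arcs = {(to_nat x, to_nat y) | x y. x \<in> V \<and> y \<in> V \<and> adj x y}, tail = fst, head = snd\<rparr>"

lemma verts_encoded_graph: "verts (encoded_graph V adj) = to_nat ` V"
  by (simp add: encoded_graph_def)

lemma arcs_ends_encoded_graph:
  "arcs_ends (encoded_graph V adj) = {(to_nat x, to_nat y) | x y. x \<in> V \<and> y \<in> V \<and> adj x y}"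
  by (force simp: encoded_graph_def arcs_ends_conv)

lemma encoded_adjacent_iff [simp]:
  "(to_nat x, to_nat y) \<in> arcs_ends (encoded_graph V adj) \<longleftrightarrow> x \<in> V \<and> y \<in> V \<and> adj x y"
  by (auto simp: arcs_ends_encoded_graph)

lemma card_to_nat_image [simp]: "card (to_nat ` A) = card A"
  by (simp add: card_image)

lemma card_verts_encoded_graph: "card (verts (encoded_graph V adj)) = card V"
  by (simp add: verts_encoded_graph)

lemma graph_encoded_graph:
  assumes "finite V" "\<And>x y. adj x y \<Longrightarrow> adj y x" "\<And>x. \<not> adj x x"
  shows "graph (encoded_graph V adj)"
proof -
  let ?G = "encoded_graph V adj"
  have arcs: "arcs ?G \<subseteq> to_nat ` V \<times> to_nat ` V" by (auto simp: encoded_graph_def)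
  have "digraph ?G"
  proof
    show "finite (verts ?G)" "finite (arcs ?G)"
      using assms(1) finite_subset[OF arcs] by (auto simp: verts_encoded_graph)
  qed (use assms(3) in \<open>auto simp: encoded_graph_def arc_to_ends_def\<close>)
  moreover have "symmetric ?G"
    using assms(2) by (auto simp: symmetric_def sym_def arcs_ends_encoded_graph)
  ultimately show ?thesis by (rule digraph.graphI)
qed

lemma independent_set_encoded_iff:
  "independent_set (encoded_graph V adj) (to_nat ` A) \<longleftrightarrow>
     A \<subseteq> V \<and> (\<forall>x\<in>A. \<forall>y\<in>A. \<not> adj x y)"
  by (auto simp: independent_set_def verts_encoded_graph inj_image_subset_iff)

lemma independent_set_encodedE:
  assumes "independent_set (encoded_graph V adj) I"
  obtains A where "I = to_nat ` A" "A \<subseteq> V" "\<And>x y. x \<in> A \<Longrightarrow> y \<in> A \<Longrightarrow> \<not> adj x y"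
proof -
  obtain A where "I = to_nat ` A" "A \<subseteq> V"
    using assms by (auto simp: independent_set_def verts_encoded_graph elim!: subset_imageE)
  with assms that show thesis by (simp add: independent_set_encoded_iff)
qed

lemma proper_coloring_encodedI:
  assumes "\<And>x. x \<in> V \<Longrightarrow> c x < q"
    and "\<And>x y. x \<in> V \<Longrightarrow> y \<in> V \<Longrightarrow> adj x y \<Longrightarrow> c x \<noteq> c y"
  shows "proper_coloring (encoded_graph V adj) q (c \<circ> from_nat)"
  using assms by (auto simp: proper_coloring_def verts_encoded_graph arcs_ends_encoded_graph)

lemma card_encoded_color_class:
  "card {v \<in> verts (encoded_graph V adj). (c \<circ> from_nat) v = i} = card {x \<in> V. c x = i}"
proof -
  have "{v \<in> verts (encoded_graph V adj). (c \<circ> from_nat) v = i} = to_nat ` {x \<in> V. c x = i}"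
    by (auto simp: verts_encoded_graph)
  then show ?thesis by simp
qed

section \<open>The construction\<close>

text \<open>
  \<open>Cell b j t\<close> is vertex number \<open>t\<close> of clique number \<open>j\<close> at the hub \<open>b\<close>. All leaves \<open>Leaf b m\<close> hang
  on \<open>Cell b 0 1\<close>. The cells with \<open>t = 0\<close> are kept free of leaves: they serve as representatives of
  their cliques in large independent sets, and they receive the color of the opposite hub.
\<close>
datatype vertex = Hub bool | Cell bool nat nat | Leaf bool nat

instance vertex :: countable
  by countable_datatype

fun adj :: "vertex \<Rightarrow> vertex \<Rightarrow> bool" where
  "adj (Hub b) (Hub b') \<longleftrightarrow> b \<noteq> b'"
| "adj (Hub b) (Cell b' j t) \<longleftrightarrow> b = b'"
| "adj (Cell b j t) (Hub b') \<longleftrightarrow> b = b'"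
| "adj (Cell b j t) (Cell b' j' t') \<longleftrightarrow> b = b' \<and> j = j' \<and> t \<noteq> t'"
| "adj (Cell b j t) (Leaf b' m) \<longleftrightarrow> b = b' \<and> j = 0 \<and> t = 1"
| "adj (Leaf b m) (Cell b' j t) \<longleftrightarrow> b = b' \<and> j = 0 \<and> t = 1"
| "adj (Hub b) (Leaf b' m) \<longleftrightarrow> False"
| "adj (Leaf b m) (Hub b') \<longleftrightarrow> False"
| "adj (Leaf b m) (Leaf b' m') \<longleftrightarrow> False"

lemma adj_sym: "adj x y \<Longrightarrow> adj y x"
  by (cases "(x, y)" rule: adj.cases) auto

lemma adj_irrefl: "\<not> adj x x"
  by (cases x) auto

text \<open>
  \<open>p\<close> is the number of cliques at each hub, \<open>h\<close> their size (without the hub), and \<open>r\<close> the number of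
  leaves on either side.
\<close>
context
  fixes p r h :: nat
begin

definition vertices :: "vertex set" where
  "vertices = range Hub \<union> {Cell b j t | b j t. j < p \<and> t < h} \<union> {Leaf b m | b m. m < r}"

lemma mem_vertices [simp]:
  "Hub b \<in> vertices"
  "Cell b j t \<in> vertices \<longleftrightarrow> j < p \<and> t < h"
  "Leaf b m \<in> vertices \<longleftrightarrow> m < r"
  by (auto simp: vertices_def)

abbreviation the_graph :: "(nat, nat \<times> nat) pre_digraph" where
  "the_graph \<equiv> encoded_graph vertices adj"

lemma card_hubs: "card (range Hub) = 2"
  by (simp add: card_image inj_def)

lemma card_leaves: "finite {Leaf b m | b m. m < r}" "card {Leaf b m | b m. m < r} = 2 * r"
proof -
  have eq: "{Leaf b m | b m. m < r} = (\<lambda>(b, m). Leaf b m) ` (UNIV \<times> {..<r})" by auto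
  show "finite {Leaf b m | b m. m < r}" unfolding eq by simp
  show "card {Leaf b m | b m. m < r} = 2 * r"
    unfolding eq by (subst card_image) (auto simp: inj_on_def card_cartesian_product)
qed

lemma card_cells:
  "finite {Cell b j t | b j t. j < p \<and> t < l}"
  "card {Cell b j t | b j t. j < p \<and> t < l} = 2 * (p * l)"
proof -
  have eq: "{Cell b j t | b j t. j < p \<and> t < l} =
      (\<lambda>(b, j, t). Cell b j t) ` (UNIV \<times> {..<p} \<times> {..<l})" by force
  show "finite {Cell b j t | b j t. j < p \<and> t < l}" unfolding eq by simp
  show "card {Cell b j t | b j t. j < p \<and> t < l} = 2 * (p * l)"
    unfolding eq by (subst card_image) (auto simp: inj_on_def card_cartesian_product)
qed

lemma finite_vertices: "finite vertices"
  unfolding vertices_def using card_leaves(1) card_cells(1) by simp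

text \<open>
  The number \<open>l\<close> of cells per clique is a parameter because the count is needed twice: for the whole
  graph, and with \<open>l = 1\<close> for one representative per clique.
\<close>
lemma card_hubs_cells_leaves:
  "card (range Hub \<union> {Cell b j t | b j t. j < p \<and> t < l} \<union> {Leaf b m | b m. m < r}) =
     2 + 2 * (p * l) + 2 * r"
  by (subst card_Un_disjoint, use card_leaves(1) card_cells(1) in force, use card_leaves in force,
      force, subst card_Un_disjoint)
    (use card_leaves card_cells card_hubs in auto)

lemma card_vertices: "card vertices = 2 + 2 * (p * h) + 2 * r"
  unfolding vertices_def by (rule card_hubs_cells_leaves)

lemma graph_the_graph: "graph the_graph"
  using finite_vertices adj_sym adj_irrefl by (rule graph_encoded_graph)

lemma connected_the_graph:
  assumes "0 < p" "1 < h"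
  shows "connected the_graph"
proof -
  interpret graph the_graph by (rule graph_the_graph)
  have hub: "to_nat (Hub b) \<rightarrow>\<^sup>*\<^bsub>the_graph\<^esub> to_nat (Hub False)" for b
    by (cases b) (auto simp: verts_encoded_graph)
  have cell: "to_nat (Cell b j t) \<rightarrow>\<^sup>*\<^bsub>the_graph\<^esub> to_nat (Hub False)"
    if "j < p" "t < h" for b j t
    using that by (intro adj_reachable_trans[OF _ hub[of b]]) simp
  have leaf: "to_nat (Leaf b m) \<rightarrow>\<^sup>*\<^bsub>the_graph\<^esub> to_nat (Hub False)" if "m < r" for b m
    using that assms by (intro adj_reachable_trans[OF _ cell[of 0 1 b]]) auto
  show ?thesis
  proof (rule connectedI_reachable)
    show "to_nat (Hub False) \<in> verts the_graph" by (simp add: verts_encoded_graph)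
    fix v assume "v \<in> verts the_graph"
    then show "v \<rightarrow>\<^sup>*\<^bsub>the_graph\<^esub> to_nat (Hub False)"
      using hub cell leaf by (auto simp: verts_encoded_graph vertices_def)
  qed
qed

text \<open>The part of the graph that hangs on the hub \<open>b\<close> through clique number \<open>j\<close>.\<close>
definition branch :: "bool \<Rightarrow> nat \<Rightarrow> vertex set" where
  "branch b j = range (Cell b j) \<union> (if j = 0 then range (Leaf b) else {})"

text \<open>
  The cell carrying a leaf separates the leaf from everything else. Removing the hub \<open>b\<close> splits off
  each \<open>branch b j\<close>, and two nonadjacent vertices that are not leaves never lie in one branch
  together with its hub, so one of the branches separates them.
\<close>
lemma nonadjacent_separated:
  assumes "x \<noteq> y" "\<not> adj x y"
  obtains v S where "v \<noteq> x" "v \<noteq> y" "x \<in> S \<longleftrightarrow> y \<notin> S"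
    "\<And>x' y'. adj x' y' \<Longrightarrow> x' \<noteq> v \<Longrightarrow> y' \<noteq> v \<Longrightarrow> x' \<in> S \<longleftrightarrow> y' \<in> S"
proof -
  have leaf: "x' \<in> {Leaf b m} \<longleftrightarrow> y' \<in> {Leaf b m}"
    if "adj x' y'" "x' \<noteq> Cell b 0 1" "y' \<noteq> Cell b 0 1" for b m x' y'
    using that by (cases "(x', y')" rule: adj.cases) auto
  have branch: "x' \<in> branch b j \<longleftrightarrow> y' \<in> branch b j"
    if "adj x' y'" "x' \<noteq> Hub b" "y' \<noteq> Hub b" for b j x' y'
    using that by (cases "(x', y')" rule: adj.cases) (auto simp: branch_def)
  note leafI = that[of "Cell b 0 1" "{Leaf b m}" for b m]
    and branchI = that[of "Hub b" "branch b j" for b j]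
  show thesis
  proof (cases "(x, y)" rule: adj.cases)
    case (1 b b')
    with assms show thesis by auto
  next
    case (2 b b' j t)
    with assms show thesis by (intro branchI[of b' j] branch) (auto simp: branch_def)
  next
    case (3 b j t b')
    with assms show thesis by (intro branchI[of b j] branch) (auto simp: branch_def)
  next
    case (4 b j t b' j' t')
    with assms show thesis by (intro branchI[of b j] branch) (auto simp: branch_def)
  next
    case (5 b j t b' m)
    with assms show thesis by (intro leafI[of b' m] leaf) auto
  next
    case (6 b m b' j t)
    with assms show thesis by (intro leafI[of b m] leaf) auto
  next
    case (7 b b' m)
    with assms show thesis by (intro leafI[of b' m] leaf) auto
  next
    case (8 b m b')
    with assms show thesis by (intro leafI[of b m] leaf) auto
  next
    case (9 b m b' m')
    with assms show thesis by (intro leafI[of b m] leaf) auto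
  qed
qed

lemma block_graph_the_graph: "block_graph the_graph"
proof (rule block_graphI_separated[OF graph_the_graph])
  fix a b
  assume "a \<in> verts the_graph" "b \<in> verts the_graph" "a \<noteq> b" "(a, b) \<notin> arcs_ends the_graph"
  then obtain x y where xy: "a = to_nat x" "b = to_nat y" "x \<noteq> y" "\<not> adj x y"
    by (auto simp: verts_encoded_graph)
  from nonadjacent_separated[OF xy(3,4)] obtain v S where v: "v \<noteq> x" "v \<noteq> y"
    and ne: "x \<in> S \<longleftrightarrow> y \<notin> S"
    and S: "\<And>x' y'. adj x' y' \<Longrightarrow> x' \<noteq> v \<Longrightarrow> y' \<noteq> v \<Longrightarrow> x' \<in> S \<longleftrightarrow> y' \<in> S"
    by metis
  show "\<exists>v S. v \<noteq> a \<and> v \<noteq> b \<and> (a \<in> S \<longleftrightarrow> b \<notin> S) \<and>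
        (\<forall>(x, y) \<in> arcs_ends the_graph. x \<noteq> v \<longrightarrow> y \<noteq> v \<longrightarrow> (x \<in> S \<longleftrightarrow> y \<in> S))"
    by (rule exI[of _ "to_nat v"], rule exI[of _ "to_nat ` S"])
      (use v ne S in \<open>auto simp: xy arcs_ends_encoded_graph inj_image_mem_iff\<close>)
qed

text \<open>
  Colors 0 and 1 belong to the hubs; a leaf takes the color of the hub on its side, which does not
  see it, and the cell carrying it has a color from 2 on. The function \<open>g\<close> is left open because two
  colorings are used: \<open>t - 1\<close> wastes no color and yields the clique number, while a cyclic shift
  makes the classes equal.
\<close>
definition coloring :: "(nat \<Rightarrow> nat \<Rightarrow> nat) \<Rightarrow> vertex \<Rightarrow> nat" where
  "coloring g v = (case v of Hub b \<Rightarrow> of_bool b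
     | Cell b j t \<Rightarrow> if t = 0 then of_bool (\<not> b) else 2 + g j t
     | Leaf b m \<Rightarrow> of_bool b)"

lemma proper_coloring_coloring:
  assumes "\<And>j. j < p \<Longrightarrow> inj_on (g j) {1..<h}"
    and "\<And>j t. j < p \<Longrightarrow> t \<in> {1..<h} \<Longrightarrow> g j t < q"
  shows "proper_coloring the_graph (q + 2) (coloring g \<circ> from_nat)"
proof (rule proper_coloring_encodedI)
  fix x assume "x \<in> vertices"
  then show "coloring g x < q + 2"
    using assms(2) by (cases x) (auto simp: coloring_def of_bool_def)
next
  fix x y assume "x \<in> vertices" "y \<in> vertices" "adj x y"
  then show "coloring g x \<noteq> coloring g y"
    using assms(1) by (cases "(x, y)" rule: adj.cases)
      (auto simp: coloring_def of_bool_def inj_on_def)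
qed

lemma clique_number_the_graph:
  assumes "0 < p" "1 < h"
  shows "clique_number the_graph = h + 1"
proof -
  let ?A = "insert (Hub False) (Cell False 0 ` {..<h})"
  have "card (Cell False 0 ` {..<h}) = h"
    by (simp add: card_image inj_on_def)
  then have card: "card (to_nat ` ?A) = h + 1"
    by (simp add: image_iff del: image_insert)
  have clique: "clique the_graph (to_nat ` ?A)"
    using assms unfolding clique_def by (auto simp: verts_encoded_graph simp flip: image_insert)
  have "proper_coloring the_graph ((h - 1) + 2) (coloring (\<lambda>j t. t - 1) \<circ> from_nat)"
    by (rule proper_coloring_coloring) (auto simp: inj_on_def)
  then have "proper_coloring the_graph (card (to_nat ` ?A)) (coloring (\<lambda>j t. t - 1) \<circ> from_nat)"
    using assms unfolding card by simp
  from clique_number_eqI[OF _ clique this] show ?thesis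
    using card finite_vertices by (simp add: verts_encoded_graph del: image_insert)
qed

lemma independent_set_at_hub:
  assumes "1 < h"
  shows "\<exists>A\<subseteq>vertices. (\<forall>x\<in>A. \<forall>y\<in>A. \<not> adj x y) \<and> Hub b \<in> A \<and> card A = 1 + p + 2 * r"
proof -
  let ?C = "(\<lambda>j. Cell (\<not> b) j 0) ` {..<p}" and ?L = "{Leaf b m | b m. m < r}"
  let ?A = "insert (Hub b) (?C \<union> ?L)"
  have "card ?C = p" by (simp add: card_image inj_on_def)
  moreover have "card (?C \<union> ?L) = card ?C + card ?L"
    by (rule card_Un_disjoint) (use card_leaves in auto)
  moreover have "card ?A = Suc (card (?C \<union> ?L))"
    by (rule card_insert_disjoint) (use card_leaves in auto)
  ultimately have "card ?A = 1 + p + 2 * r"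
    using card_leaves by simp
  moreover have "?A \<subseteq> vertices" using assms by auto
  moreover have "\<forall>x\<in>?A. \<forall>y\<in>?A. \<not> adj x y" by auto
  ultimately show ?thesis by blast
qed

lemma independent_set_at_nonhub:
  assumes "1 < h" "v \<in> vertices" "v \<notin> range Hub"
  shows "\<exists>A\<subseteq>vertices. (\<forall>x\<in>A. \<forall>y\<in>A. \<not> adj x y) \<and> v \<in> A \<and> 2 * p \<le> card A"
proof (cases v)
  case (Hub b)
  with assms show ?thesis by auto
next
  case (Cell b j t)
  let ?f = "\<lambda>(b', j'). if (b', j') = (b, j) then Cell b j t else Cell b' j' 0"
  let ?A = "?f ` (UNIV \<times> {..<p})"
  have jt: "j < p" "t < h" using assms Cell by auto
  have "inj_on ?f (UNIV \<times> {..<p})" by (auto simp: inj_on_def split: if_splits)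
  then have "card ?A = 2 * p" by (simp add: card_image card_cartesian_product)
  moreover have "?A \<subseteq> vertices" using jt assms(1) by auto
  moreover have "\<forall>x\<in>?A. \<forall>y\<in>?A. \<not> adj x y" by auto
  moreover have "v \<in> ?A" using Cell jt by (auto intro!: image_eqI[of _ _ "(b, j)"])
  ultimately show ?thesis by (intro exI[of _ ?A]) simp
next
  case (Leaf b m)
  let ?C = "{Cell b j t | b j t. j < p \<and> t < 1}"
  have "card (insert v ?C) \<ge> 2 * p"
    using card_cells(2)[of 1] card_insert_le[of ?C v] by simp
  moreover have "insert v ?C \<subseteq> vertices" using assms by auto
  moreover have "\<forall>x\<in>insert v ?C. \<forall>y\<in>insert v ?C. \<not> adj x y" using Leaf by auto
  ultimately show ?thesis by (intro exI[of _ "insert v ?C"]) simp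
qed

lemma lower_bound_L_the_graph:
  assumes "0 < p" "1 < h"
    and "card vertices + 1 \<le> (h + 1) * (1 + p + 2 * r + 1)"
    and "card vertices + 1 \<le> (h + 1) * (2 * p + 1)"
  shows "lower_bound_L the_graph = h + 1"
proof -
  note omega = clique_number_the_graph[OF assms(1,2)]
  have "lower_bound_L the_graph = clique_number the_graph"
  proof (rule lower_bound_L_eq_clique_number)
    show "finite (verts the_graph)" using finite_vertices by (simp add: verts_encoded_graph)
    show "verts the_graph \<noteq> {}"
      unfolding verts_encoded_graph vertices_def by simp
  next
    fix w assume "w \<in> verts the_graph"
    then obtain v where v: "w = to_nat v" "v \<in> vertices" by (auto simp: verts_encoded_graph)
    have "\<exists>A\<subseteq>vertices. (\<forall>x\<in>A. \<forall>y\<in>A. \<not> adj x y) \<and> v \<in> A \<and>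
        (card A = 1 + p + 2 * r \<or> 2 * p \<le> card A)"
    proof (cases v)
      case (Hub b)
      with independent_set_at_hub[OF assms(2), of b] show ?thesis by metis
    next
      case (Cell b j t)
      with independent_set_at_nonhub[OF assms(2) v(2)] show ?thesis by auto
    next
      case (Leaf b m)
      with independent_set_at_nonhub[OF assms(2) v(2)] show ?thesis by auto
    qed
    then obtain A where A: "A \<subseteq> vertices" "\<forall>x\<in>A. \<forall>y\<in>A. \<not> adj x y" "v \<in> A"
      and size: "card A = 1 + p + 2 * r \<or> 2 * p \<le> card A" by blast
    have "card vertices + 1 \<le> (h + 1) * (card A + 1)"
      using size
    proof
      assume "card A = 1 + p + 2 * r"
      then show ?thesis using assms(3) by simp
    next
      assume "2 * p \<le> card A"
      then have "(h + 1) * (2 * p + 1) \<le> (h + 1) * (card A + 1)"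
        by (intro mult_le_mono2) simp
      with assms(4) show ?thesis by (rule order_trans)
    qed
    with A show "\<exists>I. independent_set the_graph I \<and> w \<in> I \<and>
        card (verts the_graph) + 1 \<le> clique_number the_graph * (card I + 1)"
      by (intro exI[of _ "to_nat ` A"])
        (auto simp: independent_set_encoded_iff card_verts_encoded_graph omega v)
  qed
  with omega show ?thesis by simp
qed

text \<open>
  In \<open>A\<close> all cells belong to the hub \<open>True\<close>, in \<open>B\<close> to the hub \<open>False\<close>, so \<open>A \<union> B\<close> has at most one
  cell in each of the \<open>2 * p\<close> cliques. Each leaf counts only once, as \<open>A\<close> and \<open>B\<close> are disjoint.
\<close>
lemma independent_sets_at_hubs_bound:
  assumes A: "A \<subseteq> vertices" "\<And>x y. x \<in> A \<Longrightarrow> y \<in> A \<Longrightarrow> \<not> adj x y" "Hub False \<in> A"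
    and B: "B \<subseteq> vertices" "\<And>x y. x \<in> B \<Longrightarrow> y \<in> B \<Longrightarrow> \<not> adj x y" "Hub True \<in> B"
    and "A \<inter> B = {}"
  shows "card A + card B \<le> 2 * (1 + p + r)"
proof -
  \<comment> \<open>Collapsing each clique to its representative is injective on \<open>A \<union> B\<close>.\<close>
  define f where "f x = (case x of Cell b j t \<Rightarrow> Cell b j 0 | _ \<Rightarrow> x)" for x
  have cell: "Cell b j t \<in> (if b then A else B)" if "Cell b j t \<in> A \<union> B" for b j t
    using that A(2)[OF A(3)] B(2)[OF B(3)] by (cases b) (force simp: adj.simps)+
  have unique: "t = t'" if "Cell b j t \<in> A \<union> B" "Cell b j t' \<in> A \<union> B" for b j t t'
    using cell[OF that(1)] cell[OF that(2)] A(2) B(2)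
    by (metis (full_types) adj.simps(4))
  have "inj_on f (A \<union> B)"
    using unique by (auto simp: inj_on_def f_def split: vertex.splits)
  moreover have "f ` (A \<union> B) \<subseteq>
      range Hub \<union> {Cell b j t | b j t. j < p \<and> t < 1} \<union> {Leaf b m | b m. m < r}"
    using A(1) B(1) by (auto simp: f_def vertices_def split: vertex.splits)
  ultimately have "card (A \<union> B) \<le> 2 + 2 * (p * 1) + 2 * r"
    unfolding card_hubs_cells_leaves[of 1, symmetric]
    by (intro card_inj_on_le[of f]) (use card_leaves card_cells[of 1] in auto)
  moreover have "card (A \<union> B) = card A + card B"
    using A(1) B(1) finite_vertices assms(7) by (intro card_Un_disjoint) (auto intro: finite_subset)
  ultimately show ?thesis by simp
qed

lemma no_equitable_coloring_the_graph:
  assumes "q * (2 + p + r) \<le> card vertices"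
  shows "\<not> equitable_coloring the_graph q c"
proof (rule no_equitable_coloring_if_starved_edge)
  show "(to_nat (Hub False), to_nat (Hub True)) \<in> arcs_ends the_graph" by simp
  show "to_nat (Hub False) \<in> verts the_graph" "to_nat (Hub True) \<in> verts the_graph"
    by (simp_all add: verts_encoded_graph)
  show "q * (2 + p + r) \<le> card (verts the_graph)"
    using assms by (simp add: card_verts_encoded_graph)
  fix I J
  assume "independent_set the_graph I" "independent_set the_graph J"
    and hubs: "to_nat (Hub False) \<in> I" "to_nat (Hub True) \<in> J" "I \<inter> J = {}"
  then obtain A B where "I = to_nat ` A" "A \<subseteq> vertices" "\<And>x y. x \<in> A \<Longrightarrow> y \<in> A \<Longrightarrow> \<not> adj x y"
    and "J = to_nat ` B" "B \<subseteq> vertices" "\<And>x y. x \<in> B \<Longrightarrow> y \<in> B \<Longrightarrow> \<not> adj x y"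
    by (metis independent_set_encodedE)
  moreover from this hubs have "Hub False \<in> A" "Hub True \<in> B" "A \<inter> B = {}"
    by (auto simp: inj_image_mem_iff)
  ultimately have "card A + card B \<le> 2 * (1 + p + r)"
    by (intro independent_sets_at_hubs_bound)
  with \<open>I = to_nat ` A\<close> \<open>J = to_nat ` B\<close> show "card I + card J < 2 * (2 + p + r)"
    by simp
qed

lemma mod_less_double:
  fixes m n :: nat
  assumes "m < 2 * n"
  shows "m mod n = (if m < n then m else m - n)"
  using assms by (simp add: le_mod_geq)

text \<open>
  For each \<open>b\<close> and \<open>t\<close> exactly one \<open>j\<close> solves \<open>j + t = i\<close> modulo \<open>p\<close>, and the position \<open>t\<close> ranges
  over \<open>h - 1\<close> values.
\<close>
lemma card_shifted_class:
  assumes "h \<le> p" "i < p"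
  shows "card {v \<in> vertices. coloring (\<lambda>j t. (j + t) mod p) v = 2 + i} = 2 * (h - 1)"
proof -
  have shift: "(j + t) mod p = i \<longleftrightarrow> j = (i + p - t) mod p" if "j < p" "t < p" for j t
    using that assms(2) mod_less_double[of "j + t" p] mod_less_double[of "i + p - t" p]
    by (simp split: if_splits) linarith+
  have "{v \<in> vertices. coloring (\<lambda>j t. (j + t) mod p) v = 2 + i} =
      (\<lambda>(b, t). Cell b ((i + p - t) mod p) t) ` (UNIV \<times> {1..<h})" (is "?L = ?R")
  proof
    show "?L \<subseteq> ?R"
    proof
      fix v assume v: "v \<in> ?L"
      then obtain b j t where "v = Cell b j t" "0 < t" "t < h" "j < p" "(j + t) mod p = i"
        by (auto simp: coloring_def of_bool_def vertices_def split: if_splits)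
      with shift[of j t] assms show "v \<in> ?R"
        by (auto intro!: image_eqI[of _ _ "(b, t)"])
    qed
    show "?R \<subseteq> ?L"
      using shift assms by (auto simp: coloring_def)
  qed
  moreover have "inj_on (\<lambda>(b, t). Cell b ((i + p - t) mod p) t) (UNIV \<times> {1..<h})"
    by (auto simp: inj_on_def)
  ultimately show ?thesis by (simp add: card_image card_cartesian_product)
qed

lemma card_hub_class:
  assumes "0 < h"
  shows "card {v \<in> vertices. coloring g v = of_bool b} = 1 + p + r"
proof -
  let ?C = "(\<lambda>j. Cell (\<not> b) j 0) ` {..<p}" and ?L = "Leaf b ` {..<r}"
  have "{v \<in> vertices. coloring g v = of_bool b} = insert (Hub b) (?C \<union> ?L)"
    using assms by (auto simp: coloring_def vertices_def of_bool_def split: if_splits)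
  moreover have "card (?C \<union> ?L) = p + r"
    by (subst card_Un_disjoint) (auto simp: card_image inj_on_def)
  moreover have "card (insert (Hub b) (?C \<union> ?L)) = Suc (card (?C \<union> ?L))"
    by (rule card_insert_disjoint) auto
  ultimately show ?thesis by simp
qed

text \<open>
  The last assumption balances the two kinds of classes. It also makes \<open>p + 2\<close> divide the number of
  vertices, so that equitable means equal.
\<close>
lemma equitable_coloring_the_graph:
  assumes "0 < h" "h \<le> p" "1 + p + r = 2 * (h - 1)"
  shows "equitable_coloring the_graph (p + 2) (coloring (\<lambda>j t. (j + t) mod p) \<circ> from_nat)"
proof (rule equitable_coloringI_equal_classes)
  let ?c = "coloring (\<lambda>j t. (j + t) mod p)"
  have "inj_on (\<lambda>t. (j + t) mod p) {1..<h}" if "j < p" for j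
  proof (rule inj_onI)
    fix t t' assume t: "t \<in> {1..<h}" "t' \<in> {1..<h}" "(j + t) mod p = (j + t') mod p"
    then have "t < p" "t' < p" using assms by auto
    with t(3) that show "t = t'"
      by (simp add: mod_less_double split: if_splits)
  qed
  then show "proper_coloring the_graph (p + 2) (?c \<circ> from_nat)"
    by (rule proper_coloring_coloring) auto
  obtain l where "h = l + 1" using assms(1) by (metis Suc_eq_plus1 gr0_implies_Suc)
  then show "card (verts the_graph) = (p + 2) * (2 * (h - 1))"
    using assms(3) unfolding card_verts_encoded_graph card_vertices
    by (simp add: algebra_simps)
  fix i assume "i < p + 2"
  then consider b where "i = of_bool b" | j where "i = 2 + j" "j < p"
  proof -
    have "i = of_bool False \<or> i = of_bool True \<or> i = 2 + (i - 2) \<and> i - 2 < p"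
      using \<open>i < p + 2\<close> by (simp only: of_bool_eq) arith
    with that show thesis by blast
  qed
  then show "card {v \<in> verts the_graph. (?c \<circ> from_nat) v = i} = 2 * (h - 1)"
    unfolding card_encoded_color_class
  proof cases
    case (1 b)
    show "card {v \<in> vertices. ?c v = i} = 2 * (h - 1)"
      unfolding 1 card_hub_class[OF assms(1)] by (rule assms(3))
  next
    case (2 j)
    show "card {v \<in> vertices. ?c v = i} = 2 * (h - 1)"
      unfolding 2(1) using assms(2) 2(2) by (rule card_shifted_class)
  qed
qed simp

end

theorem theorem2:
  fixes d k :: nat
  assumes "2 \<le> d" and "4 * d - 1 \<le> k"
  shows "\<exists>G :: (nat, nat \<times> nat) pre_digraph.
           graph G \<and> connected G \<and> block_graph G \<and>
           lower_bound_L G = k \<and> equitable_chromatic_number G = k + d"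
proof -
  define r where "r = k - d - 3"
  define p where "p = k + d - 2"
  define h where "h = k - 1"
  define G where "G = the_graph p r h"
  have k: "k = r + d + 3" using assms by (simp add: r_def)
  have p: "p = r + 2 * d + 1" and h: "h = r + d + 2" using k by (simp_all add: p_def h_def)
  have r: "3 * d \<le> r + 4" using assms k by simp
  have card: "card (vertices p r h) = (k + d) * (2 * (r + d + 1))"
    unfolding card_vertices k p h by (simp add: algebra_simps)
  have "lower_bound_L G = h + 1"
    unfolding G_def
  proof (rule lower_bound_L_the_graph)
    show "0 < p" "1 < h" by (simp_all add: p h)
    \<comment> \<open>In terms of the slacks \<open>e = d - 2\<close> and \<open>f = k - (4 * d - 1)\<close> both sides of the first inequality
      become polynomials with nonnegative coefficients, to be compared term by term.\<close>
    obtain e where d: "d = e + 2" using assms(1) by (metis add.commute le_Suc_ex)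
    define f where "f = r - (3 * e + 2)"
    then have f: "r = f + 3 * e + 2" using r d by simp
    show "card (vertices p r h) + 1 \<le> (h + 1) * (1 + p + 2 * r + 1)"
      unfolding card unfolding k p h f d by (simp add: algebra_simps)
    show "card (vertices p r h) + 1 \<le> (h + 1) * (2 * p + 1)"
      unfolding card unfolding k p h by (simp add: algebra_simps)
  qed
  moreover have "equitable_chromatic_number G = k + d"
    unfolding equitable_chromatic_number_def
  proof (rule Least_equality)
    have "equitable_coloring G (p + 2) (coloring (\<lambda>j t. (j + t) mod p) \<circ> from_nat)"
      unfolding G_def by (rule equitable_coloring_the_graph) (use assms(1) in \<open>simp_all add: p h\<close>)
    moreover have "p + 2 = k + d" "0 < k + d" using k p by simp_all
    ultimately show "0 < k + d \<and> (\<exists>c. equitable_coloring G (k + d) c)"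
      by metis
    fix q assume q: "0 < q \<and> (\<exists>c. equitable_coloring G q c)"
    show "k + d \<le> q"
    proof (rule ccontr)
      assume "\<not> k + d \<le> q"
      \<comment> \<open>Here \<open>r + 2 * d + 2\<close> is \<open>k + d - 1\<close>, the largest number of colors to be excluded.\<close>
      then have "q * (2 + p + r) \<le> (r + 2 * d + 2) * (2 + p + r)"
        using k by (intro mult_le_mono1) simp
      also have "\<dots> \<le> card (vertices p r h)"
        unfolding card unfolding k p by (simp add: algebra_simps)
      finally show False
        using q no_equitable_coloring_the_graph unfolding G_def by blast
    qed
  qed
  ultimately show ?thesis
    using graph_the_graph[of p r h] connected_the_graph[of p h r] block_graph_the_graph[of p r h]
    by (intro exI[of _ G]) (simp add: G_def p h k)
qed

end
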